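(* Let $L_p(S;X)$ be a uniformly convex and uniformly smooth Bochner space with $1<p<\infty$. For $A\in\mathcal A$ with $\mu(A)>0$ and for $f\in L_p(S;X)$, we have: (a) $J_pf_A\in L_q(A;X^* )$ and $(J_pf_A)_A=J_pf_A$. (b) Furthermore, $f\in L_p(A;X)\Longrightarrow J_pf\in L_q(A;X^* )$; that is, $J_p:L_p(A;X)\to L_q(A;X^* )$. (c) Moreover, for any $f\in L_p(S;X)$ with $f_A\neq\theta$, $$(J_pf)_A=\frac{\|f_A\|_{L_p(A;X)}^{p-2}}{\|f\|_{L_p(S;X)}^{p-2}}\,J_pf_A .$$ More precisely, for $s\in A$, $$(J_pf)(s)=\frac{\|f_A\|_{L_p(S;X)}^{p-2}}{\|f\|_{L_p(S;X)}^{p-2}}\,(J_pf_A)(s).$$ (d) In general, if $\mu(S\setminus A)>0$, then $(J_pf)_A\neq J_pf_A$.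
   Context: Let $(S,\mathcal A,\mu)$ be a positive measure space, $X$ a real uniformly convex and uniformly smooth Banach space with dual $X^*$, and $1<p,q<\infty$ with $\frac1p+\frac1q=1$. $L_p(S;X)$ is the Bochner space of ($\mu$-equivalence classes of) strongly measurable $f:S\to X$ with $\|f\|_{L_p(S;X)}=\left(\int_S\|f(s)\|_X^p\,d\mu(s)\right)^{1/p}<\infty$; it is a uniformly convex and uniformly smooth Banach space whose dual is identified with $L_q(S;X^* )$ via $\langle\varphi,f\rangle_{L_p}=\int_S\langle\varphi(s),f(s)\rangle\,d\mu(s)$. The normalized duality mapping $J_p:L_p(S;X)\to L_q(S;X^* )$ is the single-valued map characterized by $\langle J_pf,f\rangle_{L_p}=\|J_pf\|_{L_q(S;X^* )}^2=\|f\|_{L_p(S;X)}^2$. For $A\in\mathcal A$ with $\mu(A)>0$, $L_p(A;X)=\{f\in L_p(S;X): f(s)=\theta\text{ for }\mu\text{-a.e. }s\in S\setminus A\}$ and $L_q(A;X^* )=\{\varphi\in L_q(S;X^* ):\varphi(s)=\theta\text{ for }\mu\text{-a.e. }s\in S\setminus A\}$ with the induced norms ($\theta$ denotes the zero vector). For $f$ in $L_p(S;X)$ (or in $L_q(S;X^* )$), $f_A$ is defined by $f_A(s)=f(s)$ for $s\in A$ and $f_A(s)=\theta$ for $s\notin A$.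
   Formalization: Part (d) fails for p=2, for f_A=θ, or for f=θ a.e. off A; it is stated for p≠2: inequality for every f with f_A≠θ and f_{S∖A}≠θ, and existence of such f if X≠{0} and A, S∖A each contain a set of finite positive measure. *)

theory Defs
  imports "HOL-Analysis.Analysis"
begin

definition uniformly_convex :: "'b::real_normed_vector itself \<Rightarrow> bool" where
  "uniformly_convex _ \<longleftrightarrow>
     (\<forall>\<epsilon>>0. \<exists>\<delta>>0. \<forall>x y :: 'b. norm x = 1 \<longrightarrow> norm y = 1 \<longrightarrow> norm (x - y) \<ge> \<epsilon> \<longrightarrow>
        norm ((x + y) /\<^sub>R 2) \<le> 1 - \<delta>)"

(* This says that the modulus of smoothness
   rho(t) = sup {(norm (x + y) + norm (x - y)) / 2 - 1 | norm x = 1, norm y = t}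
   satisfies rho(t) / t -> 0 as t -> 0+, without a supremum over a possibly empty set. *)
definition uniformly_smooth :: "'b::real_normed_vector itself \<Rightarrow> bool" where
  "uniformly_smooth _ \<longleftrightarrow>
     (\<forall>\<epsilon>>0. \<exists>\<delta>>0. \<forall>x y :: 'b. norm x = 1 \<longrightarrow> norm y \<le> \<delta> \<longrightarrow>
        (norm (x + y) + norm (x - y)) / 2 - 1 \<le> \<epsilon> * norm y)"

(* The library's borel_measurable is not adequate here, since the space need not be separable. *)
definition strongly_measurable :: "'s measure \<Rightarrow> ('s \<Rightarrow> 'b::real_normed_vector) \<Rightarrow> bool" where
  "strongly_measurable M f \<longleftrightarrow>
     (\<exists>F. (\<forall>n. simple_function M (F n)) \<and> (\<forall>s\<in>space M. (\<lambda>n. F n s) \<longlonglongrightarrow> f s))"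

(* Elements of the Bochner space are handled through representatives: Lp_space is the set of all
   representing functions, and two of them denote the same element iff they are ae_eq. *)
definition Lp_space :: "real \<Rightarrow> 's measure \<Rightarrow> ('s \<Rightarrow> 'b::real_normed_vector) set" where
  "Lp_space p M = {f. strongly_measurable M f \<and> integrable M (\<lambda>s. norm (f s) powr p)}"

definition Lp_norm :: "real \<Rightarrow> 's measure \<Rightarrow> ('s \<Rightarrow> 'b::real_normed_vector) \<Rightarrow> real" where
  "Lp_norm p M f = (\<integral>s. norm (f s) powr p \<partial>M) powr (1 / p)"

abbreviation ae_eq :: "'s measure \<Rightarrow> ('s \<Rightarrow> 'b) \<Rightarrow> ('s \<Rightarrow> 'b) \<Rightarrow> bool" where
  "ae_eq M f g \<equiv> AE s in M. f s = g s"

definition Lp_on :: "real \<Rightarrow> 's measure \<Rightarrow> 's set \<Rightarrow> ('s \<Rightarrow> 'b::real_normed_vector) set" where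
  "Lp_on p M A = {f \<in> Lp_space p M. AE s in M. s \<in> space M - A \<longrightarrow> f s = 0}"

definition zero_off :: "'s set \<Rightarrow> ('s \<Rightarrow> 'b::real_normed_vector) \<Rightarrow> 's \<Rightarrow> 'b" where
  "zero_off A f = (\<lambda>s. if s \<in> A then f s else 0)"

definition pairing ::
  "'s measure \<Rightarrow> ('s \<Rightarrow> ('a::real_normed_vector \<Rightarrow>\<^sub>L real)) \<Rightarrow> ('s \<Rightarrow> 'a) \<Rightarrow> real" where
  "pairing M \<phi> f = (\<integral>s. blinfun_apply (\<phi> s) (f s) \<partial>M)"

(* A representative of J_p f.  The defining condition depends on f and on the candidate \<phi> only up to
   a.e. equality, so ae_eq functions f are assigned the same representative; if the values lie in a
   uniformly convex and uniformly smooth space and 1/p + 1/q = 1, then a \<phi> as required exists for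
   f in Lp_space p M and is unique up to ae_eq. *)
definition Jp ::
  "real \<Rightarrow> real \<Rightarrow> 's measure \<Rightarrow> ('s \<Rightarrow> 'a::banach) \<Rightarrow> 's \<Rightarrow> ('a \<Rightarrow>\<^sub>L real)" where
  "Jp p q M f = (SOME \<phi>. \<phi> \<in> Lp_space q M \<and>
     pairing M \<phi> f = (Lp_norm q M \<phi>)\<^sup>2 \<and> (Lp_norm q M \<phi>)\<^sup>2 = (Lp_norm p M f)\<^sup>2)"

end

(* Uniform smoothness makes the one-sided directional derivative of the norm at a unit vector linear,
   so every x has a support functional; it is unique for nonzero x and depends continuously on x.
   If phi represents J_p f, Hoelder's inequality for phi and f is an equality, so the pointwise
   Young inequality is an equality almost everywhere. This gives
   J_p f (s) = ||f||^(2-p) ||f(s)||^(p-1) N(f(s)) a.e., where N x is the support functional of x, and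
   all claims are read off from this formula. *)
theory Submission
  imports Defs
begin

definition norm_slope :: "'a::real_normed_vector \<Rightarrow> 'a \<Rightarrow> real" where
  "norm_slope x y = (INF t\<in>{0<..}. (norm (x + t *\<^sub>R y) - norm x) / t)"

lemma norm_quotient_ge:
  fixes x y :: "'a::real_normed_vector"
  assumes "t > 0"
  shows "- norm y \<le> (norm (x + t *\<^sub>R y) - norm x) / t"
proof -
  have "norm x \<le> norm (x + t *\<^sub>R y) + norm (t *\<^sub>R y)"
    by (metis add_diff_cancel_right' norm_triangle_ineq4)
  with assms show ?thesis by (simp add: field_simps)
qed

lemma norm_quotient_le:
  fixes x y :: "'a::real_normed_vector"
  assumes "t > 0"
  shows "(norm (x + t *\<^sub>R y) - norm x) / t \<le> norm y"
proof -
  have "norm (x + t *\<^sub>R y) \<le> norm x + norm (t *\<^sub>R y)"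
    by (rule norm_triangle_ineq)
  with assms show ?thesis by (simp add: field_simps)
qed

lemma norm_slope_le_quotient: "t > 0 \<Longrightarrow> norm_slope x y \<le> (norm (x + t *\<^sub>R y) - norm x) / t"
  unfolding norm_slope_def
  by (rule cINF_lower) (auto intro!: bdd_belowI2[where m = "- norm y"] norm_quotient_ge)

lemma norm_slope_greatest:
  "(\<And>t. t > 0 \<Longrightarrow> m \<le> (norm (x + t *\<^sub>R y) - norm x) / t) \<Longrightarrow> m \<le> norm_slope x y"
  unfolding norm_slope_def by (rule cINF_greatest) (auto intro: exI[of _ 1])

lemma norm_slope_le: "norm_slope x y \<le> norm y"
  using norm_slope_le_quotient[of 1 x y] norm_quotient_le[of 1 x y] by simp

lemma norm_slope_zero: "norm_slope x 0 = 0"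
  by (rule antisym[OF _ norm_slope_greatest]) (use norm_slope_le[of x 0] in auto)

lemma norm_slope_self: "norm_slope x x = norm x"
proof (rule antisym[OF norm_slope_le norm_slope_greatest])
  fix t :: real assume t: "t > 0"
  have "norm (x + t *\<^sub>R x) = (1 + t) * norm x"
    using t by (metis abs_of_pos add_pos_pos norm_scaleR scaleR_add_left scaleR_one zero_less_one)
  with t show "norm x \<le> (norm (x + t *\<^sub>R x) - norm x) / t" by (simp add: field_simps)
qed

text \<open>The point at parameter \<open>t * s / (t + s)\<close> in direction \<open>y + z\<close> is the convex combination of
  \<open>x + t *\<^sub>R y\<close> and \<open>x + s *\<^sub>R z\<close> with weights \<open>s / (t + s)\<close> and \<open>t / (t + s)\<close>.\<close>
lemma norm_slope_add_le_quotients: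
  fixes x y z :: "'a::real_normed_vector"
  assumes t: "t > 0" and s: "s > 0"
  shows "norm_slope x (y + z)
    \<le> (norm (x + t *\<^sub>R y) - norm x) / t + (norm (x + s *\<^sub>R z) - norm x) / s"
proof -
  define r where "r = t * s / (t + s)"
  have r: "r > 0" using t s by (simp add: r_def)
  have "x + r *\<^sub>R (y + z) = (s / (t + s)) *\<^sub>R (x + t *\<^sub>R y) + (t / (t + s)) *\<^sub>R (x + s *\<^sub>R z)"
  proof -
    have "s / (t + s) + t / (t + s) = 1"
      using t s by (simp add: add_divide_distrib[symmetric] add.commute)
    then have "x = (s / (t + s)) *\<^sub>R x + (t / (t + s)) *\<^sub>R x"
      by (metis scaleR_add_left scaleR_one)
    then show ?thesis by (simp add: r_def algebra_simps)
  qed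
  then have "norm (x + r *\<^sub>R (y + z))
      \<le> norm ((s / (t + s)) *\<^sub>R (x + t *\<^sub>R y)) + norm ((t / (t + s)) *\<^sub>R (x + s *\<^sub>R z))"
    by (metis norm_triangle_ineq)
  also have "\<dots> = s / (t + s) * norm (x + t *\<^sub>R y) + t / (t + s) * norm (x + s *\<^sub>R z)"
    using t s by simp
  finally have "(norm (x + r *\<^sub>R (y + z)) - norm x) / r
      \<le> (s / (t + s) * norm (x + t *\<^sub>R y) + t / (t + s) * norm (x + s *\<^sub>R z) - norm x) / r"
    using r by (simp add: divide_right_mono)
  also have "\<dots> = (norm (x + t *\<^sub>R y) - norm x) / t + (norm (x + s *\<^sub>R z) - norm x) / s"
  proof -
    have "t + s \<noteq> 0" using t s by simp
    with t s show ?thesis by (simp add: r_def divide_simps) (simp add: algebra_simps)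
  qed
  finally show ?thesis using norm_slope_le_quotient[OF r, of x "y + z"] by linarith
qed

lemma norm_slope_subadd: "norm_slope x (y + z) \<le> norm_slope x y + norm_slope x z"
proof -
  have "norm_slope x (y + z) - norm_slope x y \<le> (norm (x + s *\<^sub>R z) - norm x) / s" if s: "s > 0" for s
  proof -
    have "norm_slope x (y + z) - (norm (x + s *\<^sub>R z) - norm x) / s \<le> norm_slope x y"
      by (rule norm_slope_greatest) (use norm_slope_add_le_quotients[OF _ s, of _ x y z] in \<open>force simp: algebra_simps\<close>)
    then show ?thesis by linarith
  qed
  from norm_slope_greatest[OF this] show ?thesis by linarith
qed

lemma norm_slope_scale_pos:
  assumes "c > 0"
  shows "norm_slope x (c *\<^sub>R y) = c * norm_slope x y"
proof -
  have le: "norm_slope x (c *\<^sub>R y) \<le> c * norm_slope x y" if c: "c > 0" for c y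
  proof -
    have "norm_slope x (c *\<^sub>R y) / c \<le> norm_slope x y"
    proof (rule norm_slope_greatest)
      fix t :: real assume t: "t > 0"
      have "norm_slope x (c *\<^sub>R y) \<le> (norm (x + (t / c) *\<^sub>R c *\<^sub>R y) - norm x) / (t / c)"
        by (rule norm_slope_le_quotient) (use t c in simp)
      with c t show "norm_slope x (c *\<^sub>R y) / c \<le> (norm (x + t *\<^sub>R y) - norm x) / t"
        by (simp add: field_simps)
    qed
    with c show ?thesis by (simp add: field_simps)
  qed
  from le[OF assms, of y] le[of "1 / c" "c *\<^sub>R y"] assms show ?thesis
    by (simp add: field_simps)
qed

lemma norm_slope_minus:
  fixes x y :: "'a::real_normed_vector"
  assumes smooth: "uniformly_smooth TYPE('a)" and x: "norm x = 1"
  shows "norm_slope x (- y) = - norm_slope x y"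
proof (rule antisym)
  show "- norm_slope x y \<le> norm_slope x (- y)"
    using norm_slope_subadd[of x y "- y"] by (simp add: norm_slope_zero)
  have "norm_slope x (- y) + norm_slope x y \<le> 0 + e" if e: "e > 0" for e
  proof -
    define e' where "e' = e / (2 * (norm y + 1))"
    have ny: "norm y + 1 > 0" by (smt (verit) norm_ge_zero)
    have e': "e' > 0" using e ny by (simp add: e'_def)
    obtain d where d: "d > 0" and smooth_d: "\<And>x y::'a. norm x = 1 \<Longrightarrow> norm y \<le> d \<Longrightarrow>
        (norm (x + y) + norm (x - y)) / 2 - 1 \<le> e' * norm y"
      using smooth e' unfolding uniformly_smooth_def by metis
    define t where "t = d / (norm y + 1)"
    have t: "t > 0" using d ny by (simp add: t_def)
    have "norm (t *\<^sub>R y) \<le> d"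
      using d ny by (simp add: t_def field_simps)
    then have "(norm (x + t *\<^sub>R y) + norm (x - t *\<^sub>R y)) / 2 - 1 \<le> e' * (t * norm y)"
      using smooth_d[OF x] t by fastforce
    then have "norm (x + t *\<^sub>R y) - norm x + (norm (x + t *\<^sub>R (- y)) - norm x) \<le> 2 * e' * norm y * t"
      using x by (simp add: algebra_simps)
    then have "(norm (x + t *\<^sub>R y) - norm x) / t + (norm (x + t *\<^sub>R (- y)) - norm x) / t
        \<le> 2 * e' * norm y"
      using t by (simp add: add_divide_distrib[symmetric] divide_le_eq)
    moreover have "2 * e' * norm y \<le> e"
      using e ny by (simp add: e'_def field_simps)
    ultimately show ?thesis
      using norm_slope_le_quotient[OF t, of x y] norm_slope_le_quotient[OF t, of x "- y"] by simp
  qed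
  then have "norm_slope x (- y) + norm_slope x y \<le> 0" by (rule field_le_epsilon)
  then show "norm_slope x (- y) \<le> - norm_slope x y" by simp
qed

lemma bounded_linear_norm_slope:
  fixes x :: "'a::real_normed_vector"
  assumes smooth: "uniformly_smooth TYPE('a)" and x: "norm x = 1"
  shows "bounded_linear (norm_slope x)"
proof (rule bounded_linear_intro[where K = 1])
  note minus = norm_slope_minus[OF smooth x]
  show "norm_slope x (y + z) = norm_slope x y + norm_slope x z" for y z
    using norm_slope_subadd[of x y z] norm_slope_subadd[of x "y + z" "- z"] minus[of z] by simp
  show "norm_slope x (c *\<^sub>R y) = c *\<^sub>R norm_slope x y" for c y
  proof (cases c "0::real" rule: linorder_cases)
    case less
    then show ?thesis using norm_slope_scale_pos[of "- c" x y] minus[of "c *\<^sub>R y"] by simp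
  next
    case equal
    then show ?thesis by (simp add: norm_slope_zero)
  next
    case greater
    then show ?thesis by (simp add: norm_slope_scale_pos)
  qed
  show "norm (norm_slope x y) \<le> norm y * 1" for y
    using norm_slope_le[of x y] norm_slope_le[of x "- y"] minus[of y] by simp
qed

lemma support_functional_exists:
  fixes x :: "'a::real_normed_vector"
  assumes smooth: "uniformly_smooth TYPE('a)"
  shows "\<exists>\<phi> :: 'a \<Rightarrow>\<^sub>L real. norm \<phi> \<le> 1 \<and> blinfun_apply \<phi> x = norm x"
proof (cases "x = 0")
  case True
  then show ?thesis by (intro exI[of _ 0]) simp
next
  case False
  define u where "u = x /\<^sub>R norm x"
  have u: "norm u = 1" and xu: "x = norm x *\<^sub>R u" using False by (auto simp: u_def)
  note bl = bounded_linear_norm_slope[OF smooth u]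
  define \<phi> where "\<phi> = Blinfun (norm_slope u)"
  have app: "blinfun_apply \<phi> = norm_slope u"
    using bl by (simp add: \<phi>_def bounded_linear_Blinfun_apply)
  have "norm \<phi> \<le> 1"
    by (rule norm_blinfun_bound)
      (use norm_slope_le[of u] norm_slope_minus[OF smooth u] in
        \<open>auto simp: app abs_le_iff, metis norm_minus_cancel\<close>)
  moreover have "blinfun_apply \<phi> x = norm x"
    using u by (metis xu blinfun.scaleR_right app norm_slope_self mult.right_neutral real_scaleR_def)
  ultimately show ?thesis by blast
qed

lemma support_functionals_close:
  assumes smooth: "uniformly_smooth TYPE('a::real_normed_vector)" and e: "e > 0"
  obtains d where "d > 0"
    "\<And>(x::'a) x' \<phi> \<psi>. norm x = 1 \<Longrightarrow> norm x' = 1 \<Longrightarrow> norm \<phi> \<le> 1 \<Longrightarrow> norm \<psi> \<le> 1 \<Longrightarrow>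
       blinfun_apply \<phi> x = 1 \<Longrightarrow> blinfun_apply \<psi> x' = (1::real) \<Longrightarrow> norm (x - x') \<le> d \<Longrightarrow>
       norm (\<phi> - \<psi>) \<le> e"
proof -
  define e' where "e' = e / 4"
  have e': "e' > 0" using e by (simp add: e'_def)
  obtain d where d: "d > 0" and smooth_d: "\<And>x y::'a. norm x = 1 \<Longrightarrow> norm y \<le> d \<Longrightarrow>
      (norm (x + y) + norm (x - y)) / 2 - 1 \<le> e' * norm y"
    using smooth e' unfolding uniformly_smooth_def by metis
  show thesis
  proof
    show "d * e / 2 > 0" using d e by simp
  next
    fix x x' :: 'a and \<phi> \<psi> :: "'a \<Rightarrow>\<^sub>L real"
    assume x: "norm x = 1" "norm x' = 1" and n: "norm \<phi> \<le> 1" "norm \<psi> \<le> 1"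
      and a: "blinfun_apply \<phi> x = 1" "blinfun_apply \<psi> x' = 1" and close: "norm (x - x') \<le> d * e / 2"
    have le1: "blinfun_apply \<omega> y \<le> norm y" if "norm \<omega> \<le> 1" for \<omega> :: "'a \<Rightarrow>\<^sub>L real" and y
    proof -
      have "norm (blinfun_apply \<omega> y) \<le> norm \<omega> * norm y" by (rule norm_blinfun)
      also have "\<dots> \<le> 1 * norm y" using that by (rule mult_right_mono) simp
      finally show ?thesis by simp
    qed
    have \<psi>x: "blinfun_apply \<psi> x \<ge> 1 - d * e / 2"
      using le1[OF n(2), of "x' - x"] a(2) close by (simp add: blinfun.diff_right norm_minus_commute)
    have small: "blinfun_apply (\<phi> - \<psi>) y \<le> d * e" if y: "norm y = d" for y
    proof -
      have "blinfun_apply \<phi> (x + y) + blinfun_apply \<psi> (x - y) \<le> norm (x + y) + norm (x - y)"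
        using le1[OF n(1)] le1[OF n(2)] by (rule add_mono)
      also have "\<dots> \<le> 2 + 2 * (e' * norm y)"
        using smooth_d[OF x(1) eq_refl[OF y]] by (simp only: field_simps)
      finally have "blinfun_apply (\<phi> - \<psi>) y \<le> 2 * e' * d + 1 - blinfun_apply \<psi> x"
        using y a(1) by (simp add: blinfun.diff_left blinfun.diff_right blinfun.add_right)
      with \<psi>x show ?thesis by (simp add: e'_def field_simps)
    qed
    have le: "blinfun_apply (\<phi> - \<psi>) y \<le> e * norm y" for y
    proof (cases "y = 0")
      case False
      have "blinfun_apply (\<phi> - \<psi>) ((d / norm y) *\<^sub>R y) \<le> d * e"
        by (rule small) (use False d in simp)
      with False d show ?thesis by (simp add: blinfun.scaleR_right field_simps)
    qed simp
    show "norm (\<phi> - \<psi>) \<le> e"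
    proof (rule norm_blinfun_bound)
      show "norm (blinfun_apply (\<phi> - \<psi>) y) \<le> e * norm y" for y
        using le[of y] le[of "- y"] by (simp add: blinfun.minus_right abs_le_iff)
    qed (use e in simp)
  qed
qed

lemma support_functional_unique:
  fixes x :: "'a::real_normed_vector"
  assumes smooth: "uniformly_smooth TYPE('a)" and "x \<noteq> 0" "norm \<phi> \<le> 1" "norm \<psi> \<le> 1"
    "blinfun_apply \<phi> x = norm x" "blinfun_apply \<psi> x = norm x"
  shows "\<phi> = \<psi>"
proof -
  have "norm (\<phi> - \<psi>) \<le> 0 + e" if "e > 0" for e
  proof -
    obtain d where "d > 0" and close: "\<And>(x::'a) x' \<phi> \<psi>. norm x = 1 \<Longrightarrow> norm x' = 1 \<Longrightarrow>
        norm \<phi> \<le> 1 \<Longrightarrow> norm \<psi> \<le> 1 \<Longrightarrow> blinfun_apply \<phi> x = 1 \<Longrightarrow>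
        blinfun_apply \<psi> x' = (1::real) \<Longrightarrow> norm (x - x') \<le> d \<Longrightarrow> norm (\<phi> - \<psi>) \<le> e"
      using support_functionals_close[OF smooth \<open>e > 0\<close>] by blast
    have "norm (\<phi> - \<psi>) \<le> e"
      by (rule close[where x = "x /\<^sub>R norm x" and x' = "x /\<^sub>R norm x"])
        (use assms \<open>d > 0\<close> in \<open>auto simp: blinfun.scaleR_right\<close>)
    then show ?thesis by simp
  qed
  then have "norm (\<phi> - \<psi>) \<le> 0" by (rule field_le_epsilon)
  then show ?thesis by simp
qed

definition support_functional :: "'a::real_normed_vector \<Rightarrow> 'a \<Rightarrow>\<^sub>L real" where
  "support_functional x = (SOME \<phi>. norm \<phi> \<le> 1 \<and> blinfun_apply \<phi> x = norm x)"

lemma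
  fixes x :: "'a::real_normed_vector"
  assumes "uniformly_smooth TYPE('a)"
  shows norm_support_functional_le: "norm (support_functional x) \<le> 1"
    and support_functional_apply: "blinfun_apply (support_functional x) x = norm x"
  using someI_ex[OF support_functional_exists[OF assms, of x]]
  unfolding support_functional_def by auto

lemma norm_support_functional:
  fixes x :: "'a::real_normed_vector"
  assumes smooth: "uniformly_smooth TYPE('a)" and "x \<noteq> 0"
  shows "norm (support_functional x) = 1"
proof (rule antisym)
  have "norm x \<le> norm (support_functional x) * norm x"
    using norm_blinfun[of "support_functional x" x] support_functional_apply[OF smooth, of x] by simp
  then show "1 \<le> norm (support_functional x)" using \<open>x \<noteq> 0\<close> by simp
qed (rule norm_support_functional_le[OF smooth])

lemma functional_eq_support_functional:
  fixes x :: "'a::real_normed_vector"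
  assumes smooth: "uniformly_smooth TYPE('a)" and "x \<noteq> 0"
    and eq: "blinfun_apply \<phi> x = norm \<phi> * norm x"
  shows "\<phi> = norm \<phi> *\<^sub>R support_functional x"
proof (cases "\<phi> = 0")
  case False
  then have "\<phi> /\<^sub>R norm \<phi> = support_functional x"
    by (intro support_functional_unique[OF smooth \<open>x \<noteq> 0\<close>])
      (simp_all add: eq blinfun.scaleR_left norm_support_functional_le[OF smooth]
        support_functional_apply[OF smooth])
  with False show ?thesis
    by (metis norm_eq_zero scaleR_left.zero scaleR_one right_inverse scaleR_scaleR)
qed simp

lemma isCont_support_functional:
  fixes x :: "'a::real_normed_vector"
  assumes smooth: "uniformly_smooth TYPE('a)" and x: "x \<noteq> 0"
  shows "isCont support_functional x"
  unfolding isCont_def tendsto_iff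
proof (intro allI impI)
  fix e :: real assume "e > 0"
  then have "e / 2 > 0" by simp
  obtain d where d: "d > 0" and close: "\<And>(x::'a) x' \<phi> \<psi>. norm x = 1 \<Longrightarrow> norm x' = 1 \<Longrightarrow>
      norm \<phi> \<le> 1 \<Longrightarrow> norm \<psi> \<le> 1 \<Longrightarrow> blinfun_apply \<phi> x = 1 \<Longrightarrow>
      blinfun_apply \<psi> x' = (1::real) \<Longrightarrow> norm (x - x') \<le> d \<Longrightarrow> norm (\<phi> - \<psi>) \<le> e / 2"
    using support_functionals_close[OF smooth \<open>e / 2 > 0\<close>] by blast
  have "((\<lambda>y. y /\<^sub>R norm y) \<longlongrightarrow> x /\<^sub>R norm x) (at x)"
    using x by (intro tendsto_intros) auto
  then have "\<forall>\<^sub>F y in at x. dist (y /\<^sub>R norm y) (x /\<^sub>R norm x) < d"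
    using d by (rule tendstoD)
  moreover have "\<forall>\<^sub>F y in at x. y \<noteq> 0"
    using x by (intro tendsto_imp_eventually_ne[OF tendsto_ident_at])
  ultimately show "\<forall>\<^sub>F y in at x. dist (support_functional y) (support_functional x) < e"
  proof eventually_elim
    case (elim y)
    have "norm (support_functional y - support_functional x) \<le> e / 2"
      by (rule close[where x = "y /\<^sub>R norm y" and x' = "x /\<^sub>R norm x"])
        (use x elim in \<open>simp_all add: norm_support_functional_le[OF smooth] blinfun.scaleR_right
          support_functional_apply[OF smooth] dist_norm\<close>)
    with \<open>e > 0\<close> show ?case by (simp add: dist_norm)
  qed
qed

text \<open>With \<open>r = 1\<close> this is the normalized duality map of the space.\<close>
definition duality_map :: "real \<Rightarrow> 'a::real_normed_vector \<Rightarrow> 'a \<Rightarrow>\<^sub>L real" where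
  "duality_map r x = norm x powr r *\<^sub>R support_functional x"

lemma duality_map_zero [simp]: "duality_map r 0 = 0"
  by (simp add: duality_map_def)

lemma norm_duality_map:
  fixes x :: "'a::real_normed_vector"
  assumes "uniformly_smooth TYPE('a)"
  shows "norm (duality_map r x) = norm x powr r"
  by (cases "x = 0") (simp_all add: duality_map_def norm_support_functional[OF assms])

lemma duality_map_apply:
  fixes x :: "'a::real_normed_vector"
  assumes "uniformly_smooth TYPE('a)"
  shows "blinfun_apply (duality_map r x) x = norm x powr (r + 1)"
  by (simp add: duality_map_def blinfun.scaleR_left support_functional_apply[OF assms] powr_add)

lemma isCont_duality_map:
  fixes x :: "'a::real_normed_vector"
  assumes smooth: "uniformly_smooth TYPE('a)" and r: "r > 0"
  shows "isCont (duality_map r) x"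
proof (cases "x = 0")
  case True
  have "((\<lambda>y::'a. norm y powr r) \<longlongrightarrow> 0 powr r) (at 0)"
    using r by (intro tendsto_powr' tendsto_norm_zero tendsto_ident_at tendsto_const) auto
  then have "(duality_map r \<longlongrightarrow> (0 :: 'a \<Rightarrow>\<^sub>L real)) (at 0)"
    by (intro tendsto_norm_zero_cancel[of "duality_map r"]) (simp add: norm_duality_map[OF smooth])
  with True show ?thesis by (simp add: isCont_def)
next
  case False
  then show ?thesis
    unfolding duality_map_def
    by (intro continuous_intros isCont_support_functional[OF smooth]) auto
qed

lemma Young_equality:
  fixes a b p q :: real
  assumes p: "1 < p" and q: "1 < q" and pq: "1 / p + 1 / q = 1" and a: "0 \<le> a" and b: "0 \<le> b"
    and eq: "a * b = a powr p / p + b powr q / q"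
  shows "a powr p = b powr q"
proof (cases "a = 0 \<or> b = 0")
  case True
  then show ?thesis using eq p q by auto
next
  case False
  define m where "m = a powr p / p + b powr q / q"
  have pos: "a > 0" "b > 0" using False a b by auto
  then have m: "m > 0" using p q by (simp add: m_def add_pos_pos)
  define u where "u = a powr p / m"
  define v where "v = b powr q / m"
  have uv: "u > 0" "v > 0" using pos m by (auto simp: u_def v_def)
  have "u / p + v / q = (a powr p / p + b powr q / q) / m"
    by (simp add: u_def v_def add_divide_distrib mult.commute)
  then have sum: "u / p + v / q = 1" using m by (simp add: m_def[symmetric])
  have "ln a + ln b = ln m" using pos by (metis eq ln_mult_pos m_def)
  moreover have "ln u / p = ln a - ln m / p" "ln v / q = ln b - ln m / q"
    using pos m p q by (simp_all add: u_def v_def ln_div ln_powr diff_divide_distrib)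
  moreover have "ln m / p + ln m / q = ln m"
    using pq by (metis distrib_left mult.right_neutral times_divide_eq_right)
  ultimately have "ln u / p + ln v / q = 0" by linarith
  moreover have "(u - 1) / p + (v - 1) / q = 0"
    using sum pq by (simp add: diff_divide_distrib)
  moreover have "ln u / p \<le> (u - 1) / p" "ln v / q \<le> (v - 1) / q"
    using uv p q by (auto intro!: divide_right_mono ln_le_minus_one)
  ultimately have "ln u / p = (u - 1) / p" "ln v / q = (v - 1) / q" by linarith+
  then have "ln u = u - 1" "ln v = v - 1" using p q by simp_all
  then have "u = 1" "v = 1" using uv by (auto intro: ln_eq_minus_one)
  then show ?thesis using m by (simp add: u_def v_def)
qed

lemma strongly_measurable_continuous_compose:
  assumes "strongly_measurable M f" and cont: "\<And>x. isCont g x"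
  shows "strongly_measurable M (\<lambda>s. g (f s))"
proof -
  obtain F where F: "\<And>n. simple_function M (F n)" "\<And>s. s \<in> space M \<Longrightarrow> (\<lambda>n. F n s) \<longlonglongrightarrow> f s"
    using assms(1) unfolding strongly_measurable_def by blast
  show ?thesis unfolding strongly_measurable_def
  proof (intro exI conjI allI ballI)
    show "simple_function M (\<lambda>s. g (F n s))" for n
      using F(1) by (rule simple_function_compose1)
    show "(\<lambda>n. g (F n s)) \<longlonglongrightarrow> g (f s)" if "s \<in> space M" for s
      using cont F(2)[OF that] by (rule isCont_tendsto_compose)
  qed
qed

lemma strongly_measurable_zero_off:
  assumes "strongly_measurable M f" and A: "A \<in> sets M"
  shows "strongly_measurable M (zero_off A f)"
proof -
  obtain F where F: "\<And>n. simple_function M (F n)" "\<And>s. s \<in> space M \<Longrightarrow> (\<lambda>n. F n s) \<longlonglongrightarrow> f s"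
    using assms(1) unfolding strongly_measurable_def by blast
  show ?thesis unfolding strongly_measurable_def
  proof (intro exI conjI allI ballI)
    show "simple_function M (zero_off A (F n))" for n
      unfolding zero_off_def
      by (rule simple_function_If_set) (use F A in \<open>auto simp: Int_absorb2 sets.sets_into_space\<close>)
    show "(\<lambda>n. zero_off A (F n) s) \<longlonglongrightarrow> zero_off A f s" if "s \<in> space M" for s
      using F(2)[OF that] by (simp add: zero_off_def)
  qed
qed

lemma strongly_measurable_blinfun_apply_borel:
  fixes f :: "'s \<Rightarrow> 'a::real_normed_vector" and \<phi> :: "'s \<Rightarrow> 'a \<Rightarrow>\<^sub>L real"
  assumes "strongly_measurable M \<phi>" "strongly_measurable M f"
  shows "(\<lambda>s. blinfun_apply (\<phi> s) (f s)) \<in> borel_measurable M"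
proof -
  obtain F where F: "\<And>n. simple_function M (F n)" "\<And>s. s \<in> space M \<Longrightarrow> (\<lambda>n. F n s) \<longlonglongrightarrow> f s"
    using assms(2) unfolding strongly_measurable_def by blast
  obtain G where G: "\<And>n. simple_function M (G n)" "\<And>s. s \<in> space M \<Longrightarrow> (\<lambda>n. G n s) \<longlonglongrightarrow> \<phi> s"
    using assms(1) unfolding strongly_measurable_def by blast
  show ?thesis
  proof (rule borel_measurable_LIMSEQ_real)
    show "(\<lambda>s. blinfun_apply (G n s) (F n s)) \<in> borel_measurable M" for n
      using F(1) G(1)
      by (intro borel_measurable_simple_function simple_function_compose2[where h = blinfun_apply])
    show "(\<lambda>n. blinfun_apply (G n s) (F n s)) \<longlonglongrightarrow> blinfun_apply (\<phi> s) (f s)" if "s \<in> space M" for s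
      using F(2)[OF that] G(2)[OF that] by (intro blinfun.tendsto)
  qed
qed

lemma Lp_norm_nonneg: "Lp_norm p M f \<ge> 0"
  by (simp add: Lp_norm_def)

lemma Lp_norm_powr:
  assumes "p > 0"
  shows "Lp_norm p M f powr p = (\<integral>s. norm (f s) powr p \<partial>M)"
  using assms by (simp add: Lp_norm_def powr_powr)

lemma Lp_norm_eq_0_iff:
  assumes p: "p > 0" and f: "f \<in> Lp_space p M"
  shows "Lp_norm p M f = 0 \<longleftrightarrow> ae_eq M f (\<lambda>_. 0)"
proof -
  have "Lp_norm p M f = 0 \<longleftrightarrow> (\<integral>s. norm (f s) powr p \<partial>M) = 0"
    using p by (simp add: Lp_norm_def)
  also have "\<dots> \<longleftrightarrow> (AE s in M. norm (f s) powr p = 0)"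
    by (rule integral_nonneg_eq_0_iff_AE) (use f in \<open>auto simp: Lp_space_def\<close>)
  finally show ?thesis by simp
qed

lemma zero_off_Lp_space:
  assumes f: "f \<in> Lp_space p M" and A: "A \<in> sets M"
  shows "zero_off A f \<in> Lp_space p M"
proof -
  have "integrable M (\<lambda>s. indicator A s *\<^sub>R norm (f s) powr p)"
    using f A by (intro integrable_mult_indicator) (auto simp: Lp_space_def)
  moreover have "(\<lambda>s. indicator A s *\<^sub>R norm (f s) powr p) = (\<lambda>s. norm (zero_off A f s) powr p)"
    by (auto simp: zero_off_def indicator_def)
  ultimately show ?thesis
    using f A by (simp add: Lp_space_def strongly_measurable_zero_off)
qed

lemma Lp_norm_zero_off_less:
  assumes p: "p > 0" and f: "f \<in> Lp_space p M" and A: "A \<in> sets M"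
    and nz: "\<not> ae_eq M (zero_off (space M - A) f) (\<lambda>_. 0)"
  shows "Lp_norm p M (zero_off A f) < Lp_norm p M f"
proof -
  let ?B = "space M - A"
  have B: "?B \<in> sets M" using A by auto
  have "(\<integral>s. norm (f s) powr p \<partial>M)
      = (\<integral>s. norm (zero_off A f s) powr p + norm (zero_off ?B f s) powr p \<partial>M)"
    by (intro Bochner_Integration.integral_cong) (auto simp: zero_off_def)
  also have "\<dots> = (\<integral>s. norm (zero_off A f s) powr p \<partial>M) + (\<integral>s. norm (zero_off ?B f s) powr p \<partial>M)"
    using zero_off_Lp_space[OF f A] zero_off_Lp_space[OF f B]
    by (intro Bochner_Integration.integral_add) (auto simp: Lp_space_def)
  finally have "Lp_norm p M f powr p = Lp_norm p M (zero_off A f) powr p + Lp_norm p M (zero_off ?B f) powr p"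
    using p by (simp add: Lp_norm_powr)
  moreover have "Lp_norm p M (zero_off ?B f) > 0"
    using Lp_norm_eq_0_iff[OF p zero_off_Lp_space[OF f B]] nz Lp_norm_nonneg[of p M "zero_off ?B f"]
    by (simp add: less_le)
  ultimately have "Lp_norm p M (zero_off A f) powr p < Lp_norm p M f powr p"
    by simp
  then show ?thesis
    using p powr_mono2[OF _ Lp_norm_nonneg, of p p M f "Lp_norm p M (zero_off A f)"] by force
qed

lemma duality_pair_unique:
  fixes f :: "'s \<Rightarrow> 'a::banach"
  assumes smooth: "uniformly_smooth TYPE('a)" and p: "1 < p" and q: "1 < q" and pq: "1 / p + 1 / q = 1"
    and f: "f \<in> Lp_space p M" and \<phi>: "\<phi> \<in> Lp_space q M"
    and pair: "pairing M \<phi> f = (Lp_norm q M \<phi>)\<^sup>2" and norms: "(Lp_norm q M \<phi>)\<^sup>2 = (Lp_norm p M f)\<^sup>2"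
  shows "ae_eq M \<phi> (\<lambda>s. Lp_norm p M f powr (2 - p) *\<^sub>R duality_map (p - 1) (f s))"
proof -
  define c where "c = Lp_norm p M f"
  have c\<phi>: "Lp_norm q M \<phi> = c"
    using norms power2_eq_iff_nonneg[OF Lp_norm_nonneg Lp_norm_nonneg] unfolding c_def by blast
  show ?thesis
  proof (cases "c = 0")
    case True
    then have "ae_eq M \<phi> (\<lambda>_. 0)" using Lp_norm_eq_0_iff[OF _ \<phi>] q c\<phi> by simp
    then show ?thesis using True by (simp add: c_def)
  next
    case False
    then have c: "c > 0" using Lp_norm_nonneg[of p M f] by (simp add: c_def)
    define h where "h s = (norm (f s) / c) powr p / p + (norm (\<phi> s) / c) powr q / q" for s
    have int_f: "integrable M (\<lambda>s. norm (f s) powr p)" and int_\<phi>: "integrable M (\<lambda>s. norm (\<phi> s) powr q)"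
      using f \<phi> by (auto simp: Lp_space_def)
    have h_eq: "h s = norm (f s) powr p / (c powr p * p) + norm (\<phi> s) powr q / (c powr q * q)" for s
      using c by (simp add: h_def powr_divide)
    have int_h: "integrable M h"
      unfolding h_eq[abs_def] using int_f int_\<phi> by (intro Bochner_Integration.integrable_add integrable_divide_zero) auto
    have "(\<integral>s. h s \<partial>M) = c powr p / (c powr p * p) + c powr q / (c powr q * q)"
      unfolding h_eq using int_f int_\<phi> p q Lp_norm_powr[of p M f] Lp_norm_powr[of q M \<phi>] c\<phi>
      by (simp add: c_def)
    also have "\<dots> = 1" using pq c by simp
    finally have integral_h: "(\<integral>s. h s \<partial>M) = 1" .
    have Young: "norm (f s) * norm (\<phi> s) / c\<^sup>2 \<le> h s" for s
      using Youngs_inequality[OF p q pq, of "norm (f s) / c" "norm (\<phi> s) / c"] c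
      by (simp add: h_def power2_eq_square)
    have apply_le: "\<bar>blinfun_apply (\<phi> s) (f s)\<bar> \<le> norm (f s) * norm (\<phi> s)" for s
      using norm_blinfun[of "\<phi> s" "f s"] by (simp add: mult.commute)
    have bound: "\<bar>blinfun_apply (\<phi> s) (f s) / c\<^sup>2\<bar> \<le> h s" for s
    proof -
      have "\<bar>blinfun_apply (\<phi> s) (f s) / c\<^sup>2\<bar> \<le> norm (f s) * norm (\<phi> s) / c\<^sup>2"
        using apply_le[of s] by (simp add: divide_right_mono)
      with Young[of s] show ?thesis by linarith
    qed
    have meas: "(\<lambda>s. blinfun_apply (\<phi> s) (f s)) \<in> borel_measurable M"
      using f \<phi> by (intro strongly_measurable_blinfun_apply_borel) (auto simp: Lp_space_def)
    have int: "integrable M (\<lambda>s. blinfun_apply (\<phi> s) (f s) / c\<^sup>2)"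
    proof (rule Bochner_Integration.integrable_bound[OF int_h])
      show "AE s in M. norm (blinfun_apply (\<phi> s) (f s) / c\<^sup>2) \<le> norm (h s)"
        using bound by (intro AE_I2) (metis abs_ge_self order_trans real_norm_def)
    qed (use meas in simp)
    have "(\<integral>s. h s - blinfun_apply (\<phi> s) (f s) / c\<^sup>2 \<partial>M) = 0"
      using int int_h integral_h pair c c\<phi> by (simp add: pairing_def)
    moreover have "0 \<le> h s - blinfun_apply (\<phi> s) (f s) / c\<^sup>2" for s
      using bound[of s] by linarith
    ultimately have "AE s in M. h s - blinfun_apply (\<phi> s) (f s) / c\<^sup>2 = 0"
      using int int_h by (subst (asm) integral_nonneg_eq_0_iff_AE) auto
    then show ?thesis
    proof (rule AE_mp[OF _ AE_I2], intro impI)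
      fix s assume "h s - blinfun_apply (\<phi> s) (f s) / c\<^sup>2 = 0"
      then have eq: "blinfun_apply (\<phi> s) (f s) / c\<^sup>2 = h s" by simp
      then have app: "blinfun_apply (\<phi> s) (f s) = norm (\<phi> s) * norm (f s)"
        and h: "norm (f s) * norm (\<phi> s) / c\<^sup>2 = h s"
      proof -
        have "norm (f s) * norm (\<phi> s) / c\<^sup>2 \<le> blinfun_apply (\<phi> s) (f s) / c\<^sup>2"
          using Young[of s] eq by simp
        then have "norm (f s) * norm (\<phi> s) \<le> blinfun_apply (\<phi> s) (f s)"
          using c by (simp add: divide_le_cancel)
        with apply_le[of s] show "blinfun_apply (\<phi> s) (f s) = norm (\<phi> s) * norm (f s)"
          by (simp add: mult.commute)
        with eq show "norm (f s) * norm (\<phi> s) / c\<^sup>2 = h s" by (simp add: mult.commute)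
      qed
      have "(norm (f s) / c) powr p = (norm (\<phi> s) / c) powr q"
        by (rule Young_equality[OF p q pq]) (use c h in \<open>auto simp: h_def power2_eq_square\<close>)
      then have "((norm (f s) / c) powr p) powr (1 / q) = ((norm (\<phi> s) / c) powr q) powr (1 / q)"
        by (rule arg_cong)
      moreover have "((norm (f s) / c) powr p) powr (1 / q) = (norm (f s) / c) powr (p - 1)"
      proof -
        have "p * (1 / q) = p - 1" using p q pq by (simp add: field_simps)
        then show ?thesis by (metis powr_powr)
      qed
      moreover have "((norm (\<phi> s) / c) powr q) powr (1 / q) = norm (\<phi> s) / c"
        using c q by (simp add: powr_powr)
      ultimately have "norm (\<phi> s) / c = (norm (f s) / c) powr (p - 1)" by metis
      then have "norm (\<phi> s) = c * (norm (f s) powr (p - 1) / c powr (p - 1))"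
        using c by (simp add: powr_divide field_simps)
      also have "\<dots> = c powr (2 - p) * norm (f s) powr (p - 1)"
        using c powr_diff[of c 1 "p - 1"] by simp
      finally have norm_\<phi>: "norm (\<phi> s) = c powr (2 - p) * norm (f s) powr (p - 1)" .
      show "\<phi> s = Lp_norm p M f powr (2 - p) *\<^sub>R duality_map (p - 1) (f s)"
      proof (cases "f s = 0")
        case True
        then show ?thesis using norm_\<phi> p by simp
      next
        case False
        have "\<phi> s = norm (\<phi> s) *\<^sub>R support_functional (f s)"
          by (rule functional_eq_support_functional[OF smooth False app])
        then show ?thesis using norm_\<phi> by (simp add: duality_map_def c_def)
      qed
    qed
  qed
qed

lemma duality_pair_exists:
  fixes f :: "'s \<Rightarrow> 'a::banach"
  assumes smooth: "uniformly_smooth TYPE('a)" and p: "1 < p" and q: "1 < q" and pq: "1 / p + 1 / q = 1"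
    and f: "f \<in> Lp_space p M"
  defines "\<phi> \<equiv> \<lambda>s. Lp_norm p M f powr (2 - p) *\<^sub>R duality_map (p - 1) (f s)"
  shows "\<phi> \<in> Lp_space q M" "pairing M \<phi> f = (Lp_norm q M \<phi>)\<^sup>2" "(Lp_norm q M \<phi>)\<^sup>2 = (Lp_norm p M f)\<^sup>2"
proof -
  define c where "c = Lp_norm p M f"
  have c: "c \<ge> 0" by (simp add: c_def Lp_norm_nonneg)
  have exps: "(p - 1) * q = p" "p / q = p - 1" using p q pq by (auto simp: field_simps)
  have int_f: "integrable M (\<lambda>s. norm (f s) powr p)" using f by (simp add: Lp_space_def)
  have norm_\<phi>: "norm (\<phi> s) powr q = c powr ((2 - p) * q) * norm (f s) powr p" for s
    by (simp add: \<phi>_def c_def norm_duality_map[OF smooth] powr_mult powr_powr exps(1))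
  have "strongly_measurable M \<phi>"
    unfolding \<phi>_def
    by (rule strongly_measurable_continuous_compose[where g = "\<lambda>x. _ *\<^sub>R duality_map (p - 1) x"])
      (use f p in \<open>auto simp: Lp_space_def intro!: continuous_intros isCont_duality_map[OF smooth]\<close>)
  then show "\<phi> \<in> Lp_space q M" using int_f by (simp add: Lp_space_def norm_\<phi>)
  have "Lp_norm q M \<phi> = (c powr ((2 - p) * q) * c powr p) powr (1 / q)"
    using p by (simp add: Lp_norm_def[of q] norm_\<phi> Lp_norm_powr c_def)
  also have "\<dots> = c powr (2 - p) * c powr (p - 1)"
    using q exps(2) by (simp add: powr_mult powr_powr)
  also have "\<dots> = c" using c by (simp add: powr_add[symmetric])
  finally have norm_c: "Lp_norm q M \<phi> = c" .
  then show "(Lp_norm q M \<phi>)\<^sup>2 = (Lp_norm p M f)\<^sup>2" by (simp add: c_def)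
  have "pairing M \<phi> f = c powr (2 - p) * c powr p"
    using p by (simp add: pairing_def \<phi>_def c_def blinfun.scaleR_left duality_map_apply[OF smooth] Lp_norm_powr)
  also have "\<dots> = c\<^sup>2" using c by (cases "c = 0") (simp_all add: powr_add[symmetric])
  finally show "pairing M \<phi> f = (Lp_norm q M \<phi>)\<^sup>2" using norm_c by simp
qed

lemma
  fixes f :: "'s \<Rightarrow> 'a::banach"
  assumes smooth: "uniformly_smooth TYPE('a)" and p: "1 < p" and q: "1 < q" and pq: "1 / p + 1 / q = 1"
    and f: "f \<in> Lp_space p M"
  shows Jp_Lp_space: "Jp p q M f \<in> Lp_space q M"
    and Jp_ae_eq: "ae_eq M (Jp p q M f) (\<lambda>s. Lp_norm p M f powr (2 - p) *\<^sub>R duality_map (p - 1) (f s))"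
proof -
  have "\<exists>\<phi>. \<phi> \<in> Lp_space q M \<and> pairing M \<phi> f = (Lp_norm q M \<phi>)\<^sup>2 \<and>
      (Lp_norm q M \<phi>)\<^sup>2 = (Lp_norm p M f)\<^sup>2"
    using duality_pair_exists[OF assms] by blast
  note J = someI_ex[OF this, folded Jp_def]
  then show "Jp p q M f \<in> Lp_space q M"
    and "ae_eq M (Jp p q M f) (\<lambda>s. Lp_norm p M f powr (2 - p) *\<^sub>R duality_map (p - 1) (f s))"
    using duality_pair_unique[OF assms] by auto
qed

lemma Jp_Lp_on:
  fixes f :: "'s \<Rightarrow> 'a::banach"
  assumes smooth: "uniformly_smooth TYPE('a)" and p: "1 < p" and q: "1 < q" and pq: "1 / p + 1 / q = 1"
    and f: "f \<in> Lp_on p M A"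
  shows "Jp p q M f \<in> Lp_on q M A"
proof -
  have f': "f \<in> Lp_space p M" and off: "AE s in M. s \<in> space M - A \<longrightarrow> f s = 0"
    using f by (auto simp: Lp_on_def)
  have "AE s in M. s \<in> space M - A \<longrightarrow> Jp p q M f s = 0"
    using Jp_ae_eq[OF assms(1-4) f'] off by eventually_elim auto
  with Jp_Lp_space[OF assms(1-4) f'] show ?thesis by (simp add: Lp_on_def)
qed

lemma zero_off_ae_eq_self:
  assumes "\<phi> \<in> Lp_on q M A"
  shows "ae_eq M (zero_off A \<phi>) \<phi>"
proof -
  have "AE s in M. s \<in> space M - A \<longrightarrow> \<phi> s = 0" using assms by (simp add: Lp_on_def)
  with AE_space show ?thesis by eventually_elim (auto simp: zero_off_def)
qed

lemma zero_off_Lp_on: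
  assumes "f \<in> Lp_space p M" "A \<in> sets M"
  shows "zero_off A f \<in> Lp_on p M A"
  using zero_off_Lp_space[OF assms] by (simp add: Lp_on_def) (simp add: zero_off_def)

lemma Jp_on_ae_eq:
  fixes f :: "'s \<Rightarrow> 'a::banach"
  assumes smooth: "uniformly_smooth TYPE('a)" and p: "1 < p" and q: "1 < q" and pq: "1 / p + 1 / q = 1"
    and f: "f \<in> Lp_space p M" and A: "A \<in> sets M"
    and nz: "\<not> ae_eq M (zero_off A f) (\<lambda>_. 0)"
  shows "AE s in M. s \<in> A \<longrightarrow> Jp p q M f s =
    (Lp_norm p M (zero_off A f) powr (p - 2) / Lp_norm p M f powr (p - 2)) *\<^sub>R Jp p q M (zero_off A f) s"
proof -
  note fA = zero_off_Lp_space[OF f A]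
  have a: "Lp_norm p M (zero_off A f) > 0"
    using Lp_norm_eq_0_iff[OF _ fA] nz p Lp_norm_nonneg[of p M "zero_off A f"] by (simp add: less_le)
  have scale: "Lp_norm p M (zero_off A f) powr (p - 2) / Lp_norm p M f powr (p - 2)
      * Lp_norm p M (zero_off A f) powr (2 - p) = Lp_norm p M f powr (2 - p)"
    using a powr_minus_divide[of "Lp_norm p M f" "p - 2"]
    by (simp add: powr_add[symmetric])
  from Jp_ae_eq[OF assms(1-4) f] Jp_ae_eq[OF assms(1-4) fA] show ?thesis
  proof eventually_elim
    case (elim s)
    have "zero_off A f s = f s" if "s \<in> A" using that by (simp add: zero_off_def)
    with elim scale show ?case by simp
  qed
qed

lemma Jp_not_ae_zero:
  fixes f :: "'s \<Rightarrow> 'a::banach"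
  assumes smooth: "uniformly_smooth TYPE('a)" and p: "1 < p" and q: "1 < q" and pq: "1 / p + 1 / q = 1"
    and f: "f \<in> Lp_space p M" and nz: "\<not> ae_eq M f (\<lambda>_. 0)"
  shows "\<not> ae_eq M (Jp p q M f) (\<lambda>_. 0)"
proof
  assume zero: "ae_eq M (Jp p q M f) (\<lambda>_. 0)"
  have "Lp_norm p M f \<noteq> 0" using Lp_norm_eq_0_iff[OF _ f] nz p by simp
  moreover have "x = 0" if "duality_map (p - 1) x = 0" for x :: 'a
    using that norm_duality_map[OF smooth, of "p - 1" x] by simp
  ultimately have "ae_eq M f (\<lambda>_. 0)"
    using zero Jp_ae_eq[OF assms(1-5)] by (auto elim!: eventually_elim2)
  with nz show False by simp
qed

lemma Jp_zero_off_not_ae_eq: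
  fixes f :: "'s \<Rightarrow> 'a::banach"
  assumes smooth: "uniformly_smooth TYPE('a)" and p: "1 < p" "p \<noteq> 2" and q: "1 < q"
    and pq: "1 / p + 1 / q = 1" and f: "f \<in> Lp_space p M" and A: "A \<in> sets M"
    and nz: "\<not> ae_eq M (zero_off A f) (\<lambda>_. 0)" "\<not> ae_eq M (zero_off (space M - A) f) (\<lambda>_. 0)"
  shows "\<not> ae_eq M (zero_off A (Jp p q M f)) (Jp p q M (zero_off A f))"
proof
  assume eq: "ae_eq M (zero_off A (Jp p q M f)) (Jp p q M (zero_off A f))"
  note fA = zero_off_Lp_space[OF f A]
  define a where "a = Lp_norm p M (zero_off A f)"
  define b where "b = Lp_norm p M f"
  have a: "a > 0"
    using Lp_norm_eq_0_iff[OF _ fA] nz p Lp_norm_nonneg[of p M "zero_off A f"] by (simp add: less_le a_def)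
  have ab: "a < b" using Lp_norm_zero_off_less[OF _ f A nz(2)] p by (simp add: a_def b_def)
  have "a powr (p - 2) \<noteq> b powr (p - 2)"
    using powr_less_mono2[of "p - 2" a b] powr_less_mono2_neg[of "p - 2" a b] a ab p(2)
    by (cases "p < 2") auto
  then have ne: "a powr (p - 2) / b powr (p - 2) \<noteq> 1" using a ab by simp
  have "ae_eq M (Jp p q M (zero_off A f)) (\<lambda>_. 0)"
    using eq Jp_on_ae_eq[OF smooth p(1) q pq f A nz(1)]
      zero_off_ae_eq_self[OF Jp_Lp_on[OF smooth p(1) q pq zero_off_Lp_on[OF f A]]]
  proof eventually_elim
    case (elim s)
    show ?case
    proof (cases "s \<in> A")
      case True
      with elim have "Jp p q M (zero_off A f) s = (a powr (p - 2) / b powr (p - 2)) *\<^sub>R Jp p q M (zero_off A f) s"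
        by (simp add: zero_off_def a_def b_def)
      with ne show ?thesis by (metis scaleR_cancel_right scaleR_one)
    next
      case False
      with elim show ?thesis by (simp add: zero_off_def)
    qed
  qed
  with Jp_not_ae_zero[OF smooth p(1) q pq fA nz(1)] show False by simp
qed

lemma indicator_Lp_space:
  fixes x :: "'a::real_normed_vector"
  assumes B: "B \<in> sets M" "emeasure M B < \<infinity>"
  shows "(\<lambda>s. if s \<in> B then x else 0) \<in> Lp_space p M"
proof -
  have "simple_function M (\<lambda>s. if s \<in> B then x else 0)"
    using B by (intro simple_function_If_set) (auto simp: Int_absorb2 sets.sets_into_space)
  then have "strongly_measurable M (\<lambda>s. if s \<in> B then x else 0)"
    unfolding strongly_measurable_def by (intro exI[of _ "\<lambda>_ s. if s \<in> B then x else 0"]) auto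
  moreover have "integrable M (\<lambda>s. indicator B s *\<^sub>R norm x powr p)"
    using B by (intro integrable_indicator) auto
  moreover have eq: "(\<lambda>s. norm (if s \<in> B then x else 0) powr p) = (\<lambda>s. indicator B s *\<^sub>R norm x powr p)"
    by (auto simp: indicator_def)
  ultimately show ?thesis by (simp only: Lp_space_def mem_Collect_eq eq simp_thms)
qed

lemma not_ae_zero_onI:
  assumes "B \<in> sets M" "0 < emeasure M B" "\<And>s. s \<in> B \<Longrightarrow> f s \<noteq> 0"
  shows "\<not> ae_eq M f (\<lambda>_. 0)"
proof
  assume "ae_eq M f (\<lambda>_. 0)"
  then have "AE s in M. s \<notin> B" by eventually_elim (use assms(3) in auto)
  then have "B \<in> null_sets M" using assms(1) by (simp add: AE_iff_null_sets)
  with assms(2) show False by auto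
qed

theorem lemma3p4:
  fixes M :: "'s measure" and A :: "'s set" and f :: "'s \<Rightarrow> 'a::banach" and p q :: real
  assumes "uniformly_convex TYPE('a)" and "uniformly_smooth TYPE('a)"
    and "1 < p" and "1 < q" and "1 / p + 1 / q = 1"
    and "A \<in> sets M" and "emeasure M A > 0"
    and "f \<in> Lp_space p M"
  shows
    "(Jp p q M (zero_off A f) \<in> Lp_on q M A \<and>
      ae_eq M (zero_off A (Jp p q M (zero_off A f))) (Jp p q M (zero_off A f)))
     \<and>
     (f \<in> Lp_on p M A \<longrightarrow> Jp p q M f \<in> Lp_on q M A)
     \<and>
     (\<not> ae_eq M (zero_off A f) (\<lambda>_. 0) \<longrightarrow>
        ae_eq M (zero_off A (Jp p q M f))
          (\<lambda>s. (Lp_norm p M (zero_off A f) powr (p - 2) / Lp_norm p M f powr (p - 2))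
                 *\<^sub>R Jp p q M (zero_off A f) s)
        \<and>
        (AE s in M. s \<in> A \<longrightarrow>
           Jp p q M f s =
             (Lp_norm p M (zero_off A f) powr (p - 2) / Lp_norm p M f powr (p - 2))
               *\<^sub>R Jp p q M (zero_off A f) s))
     \<and>
     (emeasure M (space M - A) > 0 \<and> p \<noteq> 2 \<longrightarrow>
        (\<not> ae_eq M (zero_off A f) (\<lambda>_. 0) \<and> \<not> ae_eq M (zero_off (space M - A) f) (\<lambda>_. 0) \<longrightarrow>
           \<not> ae_eq M (zero_off A (Jp p q M f)) (Jp p q M (zero_off A f)))
        \<and>
        ((\<exists>x::'a. x \<noteq> 0) \<and>
         (\<exists>B\<in>sets M. B \<subseteq> A \<and> 0 < emeasure M B \<and> emeasure M B < \<infinity>) \<and>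
         (\<exists>C\<in>sets M. C \<subseteq> space M - A \<and> 0 < emeasure M C \<and> emeasure M C < \<infinity>) \<longrightarrow>
           (\<exists>g :: 's \<Rightarrow> 'a. g \<in> Lp_space p M \<and>
              \<not> ae_eq M (zero_off A (Jp p q M g)) (Jp p q M (zero_off A g)))))"
proof (intro conjI impI)
  note smooth = assms(2) and p = assms(3) and q = assms(4) and pq = assms(5) and A = assms(6) and f = assms(8)
  note J = smooth p q pq
  show JA: "Jp p q M (zero_off A f) \<in> Lp_on q M A"
    by (rule Jp_Lp_on[OF J zero_off_Lp_on[OF f A]])
  show "ae_eq M (zero_off A (Jp p q M (zero_off A f))) (Jp p q M (zero_off A f))"
    by (rule zero_off_ae_eq_self[OF JA])
  show "Jp p q M f \<in> Lp_on q M A" if "f \<in> Lp_on p M A"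
    by (rule Jp_Lp_on[OF J that])
  let ?c = "Lp_norm p M (zero_off A f) powr (p - 2) / Lp_norm p M f powr (p - 2)"
  show on_A: "AE s in M. s \<in> A \<longrightarrow> Jp p q M f s = ?c *\<^sub>R Jp p q M (zero_off A f) s"
    if "\<not> ae_eq M (zero_off A f) (\<lambda>_. 0)"
    by (rule Jp_on_ae_eq[OF J f A that])
  show "ae_eq M (zero_off A (Jp p q M f)) (\<lambda>s. ?c *\<^sub>R Jp p q M (zero_off A f) s)"
    if "\<not> ae_eq M (zero_off A f) (\<lambda>_. 0)"
    using on_A[OF that] zero_off_ae_eq_self[OF JA]
    by eventually_elim (auto simp: zero_off_def split: if_splits)
  show "\<not> ae_eq M (zero_off A (Jp p q M f)) (Jp p q M (zero_off A f))"
    if "emeasure M (space M - A) > 0 \<and> p \<noteq> 2"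
      "\<not> ae_eq M (zero_off A f) (\<lambda>_. 0) \<and> \<not> ae_eq M (zero_off (space M - A) f) (\<lambda>_. 0)"
    using that Jp_zero_off_not_ae_eq[OF smooth p _ q pq f A] by blast
  show "\<exists>g :: 's \<Rightarrow> 'a. g \<in> Lp_space p M \<and> \<not> ae_eq M (zero_off A (Jp p q M g)) (Jp p q M (zero_off A g))"
    if p2: "emeasure M (space M - A) > 0 \<and> p \<noteq> 2"
      and ex: "(\<exists>x::'a. x \<noteq> 0) \<and>
         (\<exists>B\<in>sets M. B \<subseteq> A \<and> 0 < emeasure M B \<and> emeasure M B < \<infinity>) \<and>
         (\<exists>C\<in>sets M. C \<subseteq> space M - A \<and> 0 < emeasure M C \<and> emeasure M C < \<infinity>)"
  proof -
    obtain x :: 'a and B C where x: "x \<noteq> 0"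
      and B: "B \<in> sets M" "B \<subseteq> A" "0 < emeasure M B" "emeasure M B < \<infinity>"
      and C: "C \<in> sets M" "C \<subseteq> space M - A" "0 < emeasure M C" "emeasure M C < \<infinity>"
      using ex by blast
    define g where "g s = (if s \<in> B \<union> C then x else 0)" for s
    have "emeasure M (B \<union> C) \<le> emeasure M B + emeasure M C"
      using B C by (intro emeasure_subadditive) auto
    also have "\<dots> < \<infinity>" using B C by simp
    finally have g: "g \<in> Lp_space p M"
      unfolding g_def[abs_def] using B C by (intro indicator_Lp_space) auto
    have "\<not> ae_eq M (zero_off A g) (\<lambda>_. 0)"
      by (rule not_ae_zero_onI[OF B(1,3)]) (use B(2) x in \<open>auto simp: zero_off_def g_def\<close>)
    moreover have "\<not> ae_eq M (zero_off (space M - A) g) (\<lambda>_. 0)"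
      by (rule not_ae_zero_onI[OF C(1,3)]) (use C(2) x in \<open>auto simp: zero_off_def g_def\<close>)
    ultimately show ?thesis
      using g p2 Jp_zero_off_not_ae_eq[OF smooth p _ q pq g A] by blast
  qed
qed

end
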